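(* Consider the linear program of minimizing $c^T x$ over $x\in\mathbb{R}^n$ subject to the constraints $A_{\mathcal E}x=b_{\mathcal E}$ and $A_{\mathcal I}x\ge b_{\mathcal I}$. Assume that the constraints are consistent (at least one feasible point exists), that $c^T x$ is bounded below in the feasible region, and that $\operatorname{rank}(A)=n$. A point $\tilde x\in\mathbb{R}^n$ (which need not be a vertex) is optimal if and only if $\tilde x$ is feasible and there exists an $m$-vector $\tilde\lambda$ such that $A^T\tilde\lambda=c$, $\tilde\lambda^T(A\tilde x-b)=0$ and $\tilde\lambda_{\mathcal I}\ge 0$. The optimal objective value is $\tilde\lambda^T b$.
   Context: Here $A_{\mathcal E}$ is a real $m_{\mathcal E}\times n$ matrix with $\operatorname{rank}(A_{\mathcal E})=m_{\mathcal E}$ (possibly $m_{\mathcal E}=0$, i.e. no equality constraints), $A_{\mathcal I}$ is a real $m_{\mathcal I}\times n$ matrix, $b_{\mathcal E}\in\mathbb{R}^{m_{\mathcal E}}$, $b_{\mathcal I}\in\mathbb{R}^{m_{\mathcal I}}$, $c\in\mathbb{R}^n$, and $m=m_{\mathcal E}+m_{\mathcal I}$. Set $A=\begin{pmatrix} A_{\mathcal E} \\ A_{\mathcal I} \end{pmatrix}$ and $b=\begin{pmatrix} b_{\mathcal E} \\ b_{\mathcal I} \end{pmatrix}$. It is assumed that $c\neq 0$ and $A\neq 0$. Index sets: $\mathcal E=\{1,\dots,m_{\mathcal E}\}$ and $\mathcal I=\{m_{\mathcal E}+1,\dots,m\}$. Vector inequalities are componentwise. For $\lambda\in\mathbb{R}^m$,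 $\lambda_{\mathcal I}$ is the subvector of components with index in $\mathcal I$. A point $x$ is feasible if $A_{\mathcal E}x=b_{\mathcal E}$ and $A_{\mathcal I}x\ge b_{\mathcal I}$; it is optimal if it is feasible and $c^Tx\le c^Ty$ for every feasible $y$. A vertex is a feasible point at which the matrix of rows $a_i^T$ of $A$ with $a_i^Tx=b_i$ has rank $n$. *)

theory Defs
  imports Complex_Main "Jordan_Normal_Form.DL_Rank"
begin

text \<open>
  The dimensions are natural numbers and the carriers are explicit, so that matrices with no rows
  (no equality constraints) are covered.
\<close>

definition lp_feasible ::
  "nat \<Rightarrow> real mat \<Rightarrow> real vec \<Rightarrow> real mat \<Rightarrow> real vec \<Rightarrow> real vec \<Rightarrow> bool" where
  "lp_feasible n A\<^sub>E b\<^sub>E A\<^sub>I b\<^sub>I x \<longleftrightarrow>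
     x \<in> carrier_vec n \<and> A\<^sub>E *\<^sub>v x = b\<^sub>E \<and> A\<^sub>I *\<^sub>v x \<ge> b\<^sub>I"

definition lp_optimal ::
  "nat \<Rightarrow> real mat \<Rightarrow> real vec \<Rightarrow> real mat \<Rightarrow> real vec \<Rightarrow> real vec \<Rightarrow> real vec \<Rightarrow> bool" where
  "lp_optimal n A\<^sub>E b\<^sub>E A\<^sub>I b\<^sub>I c x \<longleftrightarrow>
     lp_feasible n A\<^sub>E b\<^sub>E A\<^sub>I b\<^sub>I x \<and> (\<forall>y. lp_feasible n A\<^sub>E b\<^sub>E A\<^sub>I b\<^sub>I y \<longrightarrow> c \<bullet> x \<le> c \<bullet> y)"

text \<open>
  Meaningful only if the constraints are consistent and the objective is bounded below on the
  feasible region; otherwise the real-valued infimum is an unspecified number.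
\<close>

definition lp_optimal_value ::
  "nat \<Rightarrow> real mat \<Rightarrow> real vec \<Rightarrow> real mat \<Rightarrow> real vec \<Rightarrow> real vec \<Rightarrow> real" where
  "lp_optimal_value n A\<^sub>E b\<^sub>E A\<^sub>I b\<^sub>I c = (INF x \<in> {x. lp_feasible n A\<^sub>E b\<^sub>E A\<^sub>I b\<^sub>I x}. c \<bullet> x)"

text \<open>
  The three conditions on the multiplier vector: the constraints are ordered with the equalities
  first, so the components belonging to the inequalities are the last \<open>dim_row A\<^sub>I\<close> ones.
\<close>

definition lp_multiplier ::
  "real mat \<Rightarrow> real vec \<Rightarrow> real mat \<Rightarrow> real vec \<Rightarrow> real vec \<Rightarrow> real vec \<Rightarrow> real vec \<Rightarrow> bool" where
  "lp_multiplier A\<^sub>E b\<^sub>E A\<^sub>I b\<^sub>I c x l \<longleftrightarrow>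
     (let A = A\<^sub>E @\<^sub>r A\<^sub>I; b = b\<^sub>E @\<^sub>v b\<^sub>I in
        l \<in> carrier_vec (dim_row A) \<and>
        A\<^sup>T *\<^sub>v l = c \<and>
        l \<bullet> (A *\<^sub>v x - b) = 0 \<and>
        vec_last l (dim_row A\<^sub>I) \<ge> 0\<^sub>v (dim_row A\<^sub>I))"

end

theory Submission
  imports Defs
begin

text \<open>
  At an optimal point the objective cannot decrease along any direction that keeps the active
  constraints satisfied, so Farkas' lemma writes \<open>c\<close> as a combination of the active rows of \<open>A\<close>,
  with nonnegative coefficients on the inequality rows; extended by zero, these are the multipliers.
  Conversely a multiplier bounds the objective from below by \<open>l \<bullet> b\<close> (weak duality), and
  complementarity says that \<open>x\<close> attains the bound. Farkas' lemma itself is proved by induction on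
  the number of functionals, which needs neither topology nor a dimension argument.
\<close>

section \<open>Farkas' lemma\<close>

text \<open>If functional \<open>k\<close> is redundant, its coefficient is 0. Otherwise a point
  violating the conclusion yields a projection onto the kernel of \<open>a k\<close>, and the
  induction hypothesis is applied to the projected functionals; hence \<open>a\<close> and
  \<open>c\<close> vary in the induction while \<open>J\<close> stays fixed.\<close>

lemma farkas:
  fixes a :: "'i \<Rightarrow> 'j \<Rightarrow> real" and c :: "'j \<Rightarrow> real"
  assumes "finite I" "finite J"
    and "\<And>x. (\<And>i. i \<in> I \<Longrightarrow> (\<Sum>j\<in>J. a i j * x j) \<ge> 0) \<Longrightarrow> (\<Sum>j\<in>J. c j * x j) \<ge> 0"
  shows "\<exists>l. (\<forall>i\<in>I. l i \<ge> 0) \<and> (\<forall>j\<in>J. c j = (\<Sum>i\<in>I. l i * a i j))"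
  using assms(1,3)
proof (induction I arbitrary: a c rule: finite_induct)
  case empty
  \<comment> \<open>Without constraints every point is admissible; testing at \<open>- c\<close>
    forces the sum of squares to vanish.\<close>
  have "(\<Sum>j\<in>J. c j * - c j) \<ge> 0"
    by (rule empty.prems) simp
  then have "(\<Sum>j\<in>J. c j * c j) \<le> 0"
    by (simp add: sum_negf)
  then have "(\<Sum>j\<in>J. c j * c j) = 0"
    by (intro antisym sum_nonneg) auto
  then have "\<forall>j\<in>J. c j = 0"
    using \<open>finite J\<close> by (subst (asm) sum_nonneg_eq_0_iff) auto
  then show ?case
    by simp
next
  case (insert k I)
  let ?ip = "\<lambda>u v. \<Sum>j\<in>J. u j * v j :: real"
  have lin_r: "?ip u (\<lambda>j. v j + r * w j) = ?ip u v + r * ?ip u w" for u v w r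
    by (simp add: algebra_simps sum.distrib sum_distrib_left)
  have lin_l: "?ip (\<lambda>j. u j + r * w j) v = ?ip u v + r * ?ip w v" for u v w r
    by (simp add: algebra_simps sum.distrib sum_distrib_left)
  show ?case
  proof (cases "\<forall>x. (\<forall>i\<in>I. ?ip (a i) x \<ge> 0) \<longrightarrow> ?ip c x \<ge> 0")
    case True
    obtain l where l: "\<And>i. i \<in> I \<Longrightarrow> l i \<ge> 0" "\<And>j. j \<in> J \<Longrightarrow> c j = (\<Sum>i\<in>I. l i * a i j)"
      using insert.IH[where a = a and c = c] True by metis
    have "(\<Sum>i\<in>insert k I. (l(k := 0)) i * a i j) = (\<Sum>i\<in>I. l i * a i j)" for j
      using insert.hyps by (auto intro!: sum.cong)
    then show ?thesis
      using l insert.hyps by (intro exI[of _ "l(k := 0)"]) auto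
  next
    case False
    then obtain y where y: "\<And>i. i \<in> I \<Longrightarrow> ?ip (a i) y \<ge> 0" "?ip c y < 0"
      by force
    \<comment> \<open>\<open>y\<close> satisfies all constraints in \<open>I\<close> but not the
      conclusion, so it must violate constraint \<open>k\<close>.\<close>
    have "?ip (a k) y < 0"
      using insert.prems[of y] y by force
    \<comment> \<open>Dividing by a positive number keeps all signs and normalizes the value of
      \<open>a k\<close> to -1.\<close>
    define z where "z j = y j / - ?ip (a k) y" for j
    have z_ip: "?ip u z = ?ip u y / - ?ip (a k) y" for u
      unfolding z_def by (simp add: sum_divide_distrib sum_negf)
    have zk: "?ip (a k) z = -1"
      using \<open>?ip (a k) y < 0\<close> unfolding z_ip by simp
    have zI: "?ip (a i) z \<ge> 0" if "i \<in> I" for i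
      unfolding z_ip using y(1)[OF that] \<open>?ip (a k) y < 0\<close> by (simp add: divide_le_0_iff)
    have zc: "?ip c z \<le> 0"
      unfolding z_ip using y(2) \<open>?ip (a k) y < 0\<close> by (simp add: zero_le_divide_iff)
    text \<open>Replacing each functional \<open>u\<close> by \<open>x \<mapsto> u (x + (a k x) z)\<close> restricts it to the kernel of
      \<open>a k\<close>, where the constraint indexed by \<open>k\<close> is void.\<close>
    define pr where "pr u j = u j + ?ip u z * a k j" for u j
    have pr: "?ip (pr u) x = ?ip u (\<lambda>j. x j + ?ip (a k) x * z j)" for u x
      unfolding pr_def lin_l lin_r by (simp add: mult.commute)
    \<comment> \<open>By \<open>zk\<close> the shifted point satisfies constraint \<open>k\<close>
      with equality, so only the constraints in \<open>I\<close> remain to be checked.\<close>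
    have "?ip (pr c) x \<ge> 0" if "\<And>i. i \<in> I \<Longrightarrow> ?ip (pr (a i)) x \<ge> 0" for x
      unfolding pr
    proof (rule insert.prems)
      fix i assume "i \<in> insert k I"
      then show "?ip (a i) (\<lambda>j. x j + ?ip (a k) x * z j) \<ge> 0"
        using that[of i] zk unfolding pr lin_r by auto
    qed
    then obtain l where l: "\<And>i. i \<in> I \<Longrightarrow> l i \<ge> 0"
      "\<And>j. j \<in> J \<Longrightarrow> pr c j = (\<Sum>i\<in>I. l i * pr (a i) j)"
      using insert.IH[where a = "\<lambda>i. pr (a i)" and c = "pr c"] by metis
    \<comment> \<open>Expanding \<open>pr\<close> in the identity for \<open>pr c\<close> and
      collecting the multiples of \<open>a k\<close> gives this coefficient; \<open>zI\<close> and
      \<open>zc\<close> fix its sign.\<close>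
    define r where "r = (\<Sum>i\<in>I. l i * ?ip (a i) z) - ?ip c z"
    have "r \<ge> 0"
      unfolding r_def using l(1) zI zc by (smt (verit) sum_nonneg mult_nonneg_nonneg)
    moreover have "c j = (\<Sum>i\<in>insert k I. (l(k := r)) i * a i j)" if "j \<in> J" for j
    proof -
      have "(\<Sum>i\<in>insert k I. (l(k := r)) i * a i j) = r * a k j + (\<Sum>i\<in>I. l i * a i j)"
        using insert.hyps by (auto intro!: sum.cong)
      also have "(\<Sum>i\<in>I. l i * a i j)
          = (\<Sum>i\<in>I. l i * pr (a i) j) - (\<Sum>i\<in>I. l i * ?ip (a i) z) * a k j"
        unfolding pr_def by (simp add: algebra_simps sum.distrib sum_distrib_left)
      also have "(\<Sum>i\<in>I. l i * pr (a i) j) = c j + ?ip c z * a k j"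
        using l(2)[OF that] by (simp add: pr_def)
      finally show ?thesis
        by (simp add: r_def algebra_simps)
    qed
    ultimately show ?thesis
      using l(1) insert.hyps by (intro exI[of _ "l(k := r)"]) auto
  qed
qed

text \<open>An equality is a pair of opposite inequalities, so its coefficient is a difference of
  two nonnegative ones and has free sign. Disjointness keeps the subtracted part away from
  \<open>I\<close>.\<close>

lemma farkas_equalities:
  fixes a :: "'i \<Rightarrow> 'j \<Rightarrow> real" and c :: "'j \<Rightarrow> real"
  assumes fin: "finite E" "finite I" "finite J" and disj: "E \<inter> I = {}"
    and imp: "\<And>x. (\<And>i. i \<in> E \<Longrightarrow> (\<Sum>j\<in>J. a i j * x j) = 0) \<Longrightarrow>
      (\<And>i. i \<in> I \<Longrightarrow> (\<Sum>j\<in>J. a i j * x j) \<ge> 0) \<Longrightarrow> (\<Sum>j\<in>J. c j * x j) \<ge> 0"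
  obtains l where "\<And>i. i \<in> I \<Longrightarrow> l i \<ge> 0" "\<And>j. j \<in> J \<Longrightarrow> c j = (\<Sum>i\<in>E \<union> I. l i * a i j)"
proof -
  \<comment> \<open>\<open>Inl\<close> tags the given functionals, \<open>Inr\<close> the negated
    copies of the equalities.\<close>
  let ?a = "case_sum a (\<lambda>i j. - a i j)"
  obtain l where l: "\<And>k. k \<in> (E \<union> I) <+> E \<Longrightarrow> l k \<ge> 0"
    "\<And>j. j \<in> J \<Longrightarrow> c j = (\<Sum>k\<in>(E \<union> I) <+> E. l k * ?a k j)"
  proof -
    have "\<exists>l. (\<forall>k\<in>(E \<union> I) <+> E. l k \<ge> 0) \<and>
        (\<forall>j\<in>J. c j = (\<Sum>k\<in>(E \<union> I) <+> E. l k * ?a k j))"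
    proof (rule farkas)
      show "finite ((E \<union> I) <+> E)" "finite J"
        using fin by simp_all
      fix x
      assume nonneg: "\<And>k. k \<in> (E \<union> I) <+> E \<Longrightarrow> (\<Sum>j\<in>J. ?a k j * x j) \<ge> 0"
      show "(\<Sum>j\<in>J. c j * x j) \<ge> 0"
      proof (rule imp)
        show "(\<Sum>j\<in>J. a i j * x j) = 0" if "i \<in> E" for i
          using nonneg[of "Inl i"] nonneg[of "Inr i"] that by (simp add: sum_negf InlI InrI)
        show "(\<Sum>j\<in>J. a i j * x j) \<ge> 0" if "i \<in> I" for i
          using nonneg[of "Inl i"] that by (simp add: InlI)
      qed
    qed
    then show ?thesis
      using that by metis
  qed
  define l' where "l' i = l (Inl i) - (if i \<in> E then l (Inr i) else 0)" for i
  show ?thesis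
  proof
    show "l' i \<ge> 0" if "i \<in> I" for i
      using l(1)[of "Inl i"] that disj by (auto simp: l'_def InlI)
    fix j assume "j \<in> J"
    have "(\<Sum>i\<in>E. l (Inr i) * a i j) = (\<Sum>i\<in>E \<union> I. (if i \<in> E then l (Inr i) else 0) * a i j)"
      by (rule sum.mono_neutral_cong_left) (use fin in auto)
    then show "c j = (\<Sum>i\<in>E \<union> I. l' i * a i j)"
      using l(2)[OF \<open>j \<in> J\<close>] fin
      by (simp add: sum.Plus l'_def algebra_simps sum_negf sum_subtractf)
  qed
qed

section \<open>Componentwise forms of feasibility and multipliers\<close>

text \<open>Both blocks become rows of the stacked matrix under one index range, so that later
  arguments can go row by row.\<close>

lemma lp_feasible_iff:
  assumes "A\<^sub>E \<in> carrier_mat m\<^sub>E n" "A\<^sub>I \<in> carrier_mat m\<^sub>I n"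
    and "b\<^sub>E \<in> carrier_vec m\<^sub>E" "b\<^sub>I \<in> carrier_vec m\<^sub>I"
  shows "lp_feasible n A\<^sub>E b\<^sub>E A\<^sub>I b\<^sub>I y \<longleftrightarrow> y \<in> carrier_vec n \<and>
    (\<forall>i<m\<^sub>E. ((A\<^sub>E @\<^sub>r A\<^sub>I) *\<^sub>v y) $ i = (b\<^sub>E @\<^sub>v b\<^sub>I) $ i) \<and>
    (\<forall>i\<in>{m\<^sub>E..<m\<^sub>E + m\<^sub>I}. ((A\<^sub>E @\<^sub>r A\<^sub>I) *\<^sub>v y) $ i \<ge> (b\<^sub>E @\<^sub>v b\<^sub>I) $ i)"
proof (cases "y \<in> carrier_vec n")
  case True
  have split: "(A\<^sub>E @\<^sub>r A\<^sub>I) *\<^sub>v y = (A\<^sub>E *\<^sub>v y) @\<^sub>v (A\<^sub>I *\<^sub>v y)"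
    using assms True by (simp add: mat_mult_append)
  have E: "A\<^sub>E *\<^sub>v y = b\<^sub>E \<longleftrightarrow> (\<forall>i<m\<^sub>E. ((A\<^sub>E @\<^sub>r A\<^sub>I) *\<^sub>v y) $ i = (b\<^sub>E @\<^sub>v b\<^sub>I) $ i)"
    using assms unfolding split by (auto simp: vec_eq_iff simp del: index_mult_mat_vec)
  have "b\<^sub>I \<le> A\<^sub>I *\<^sub>v y \<longleftrightarrow> (\<forall>i<m\<^sub>I. b\<^sub>I $ i \<le> (A\<^sub>I *\<^sub>v y) $ i)"
    using assms by (auto simp: less_eq_vec_def simp del: index_mult_mat_vec)
  also have "\<dots> \<longleftrightarrow> (\<forall>i\<in>{m\<^sub>E..<m\<^sub>E + m\<^sub>I}. b\<^sub>I $ (i - m\<^sub>E) \<le> (A\<^sub>I *\<^sub>v y) $ (i - m\<^sub>E))"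
    by (metis add_diff_cancel_left' atLeastLessThan_iff le_add1 le_add_diff_inverse nat_add_left_cancel_less)
  also have "\<dots> \<longleftrightarrow> (\<forall>i\<in>{m\<^sub>E..<m\<^sub>E + m\<^sub>I}. ((A\<^sub>E @\<^sub>r A\<^sub>I) *\<^sub>v y) $ i \<ge> (b\<^sub>E @\<^sub>v b\<^sub>I) $ i)"
    using assms unfolding split by (auto simp del: index_mult_mat_vec)
  finally show ?thesis
    using E True by (simp add: lp_feasible_def)
qed (simp add: lp_feasible_def)

lemma lp_multiplier_iff:
  assumes "A\<^sub>E \<in> carrier_mat m\<^sub>E n" "A\<^sub>I \<in> carrier_mat m\<^sub>I n"
  shows "lp_multiplier A\<^sub>E b\<^sub>E A\<^sub>I b\<^sub>I c x l \<longleftrightarrow> l \<in> carrier_vec (m\<^sub>E + m\<^sub>I) \<and>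
    (A\<^sub>E @\<^sub>r A\<^sub>I)\<^sup>T *\<^sub>v l = c \<and> l \<bullet> ((A\<^sub>E @\<^sub>r A\<^sub>I) *\<^sub>v x - (b\<^sub>E @\<^sub>v b\<^sub>I)) = 0 \<and>
    (\<forall>i\<in>{m\<^sub>E..<m\<^sub>E + m\<^sub>I}. l $ i \<ge> 0)"
proof -
  have "0\<^sub>v m\<^sub>I \<le> vec_last l m\<^sub>I \<longleftrightarrow> (\<forall>i\<in>{m\<^sub>E..<m\<^sub>E + m\<^sub>I}. l $ i \<ge> 0)"
    if "l \<in> carrier_vec (m\<^sub>E + m\<^sub>I)"
  proof -
    have "0\<^sub>v m\<^sub>I \<le> vec_last l m\<^sub>I \<longleftrightarrow> (\<forall>i<m\<^sub>I. l $ (m\<^sub>E + i) \<ge> 0)"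
      using that by (auto simp: less_eq_vec_def vec_last_def)
    also have "\<dots> \<longleftrightarrow> (\<forall>i\<in>{m\<^sub>E..<m\<^sub>E + m\<^sub>I}. l $ i \<ge> 0)"
      by (metis atLeastLessThan_iff le_add1 le_add_diff_inverse nat_add_left_cancel_less)
    finally show ?thesis .
  qed
  moreover have "dim_row (A\<^sub>E @\<^sub>r A\<^sub>I) = m\<^sub>E + m\<^sub>I" "dim_row A\<^sub>I = m\<^sub>I"
    using assms by (auto simp: append_rows_def)
  ultimately show ?thesis
    unfolding lp_multiplier_def Let_def by auto
qed

section \<open>Complementarity and weak duality\<close>

text \<open>Transposition moves \<open>l\<close> onto the constraint values at \<open>x\<close>, and
  complementarity replaces these by the right-hand side.\<close>

lemma lp_multiplier_objective:
  assumes A: "A\<^sub>E \<in> carrier_mat m\<^sub>E n" "A\<^sub>I \<in> carrier_mat m\<^sub>I n"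
    and b: "b\<^sub>E \<in> carrier_vec m\<^sub>E" "b\<^sub>I \<in> carrier_vec m\<^sub>I" and x: "x \<in> carrier_vec n"
    and mult: "lp_multiplier A\<^sub>E b\<^sub>E A\<^sub>I b\<^sub>I c x l"
  shows "c \<bullet> x = l \<bullet> (b\<^sub>E @\<^sub>v b\<^sub>I)"
proof -
  let ?A = "A\<^sub>E @\<^sub>r A\<^sub>I" and ?b = "b\<^sub>E @\<^sub>v b\<^sub>I"
  have cA: "?A \<in> carrier_mat (m\<^sub>E + m\<^sub>I) n" and cb: "?b \<in> carrier_vec (m\<^sub>E + m\<^sub>I)"
    using A b by auto
  have l: "l \<in> carrier_vec (m\<^sub>E + m\<^sub>I)" "?A\<^sup>T *\<^sub>v l = c" "l \<bullet> (?A *\<^sub>v x - ?b) = 0"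
    using mult unfolding lp_multiplier_iff[OF A] by auto
  have "c \<bullet> x = l \<bullet> (?A *\<^sub>v x)"
    using transpose_vec_mult_scalar[OF cA x l(1)] l(2) by simp
  moreover have "l \<bullet> (?A *\<^sub>v x - ?b) = l \<bullet> (?A *\<^sub>v x) - l \<bullet> ?b"
    using cA cb x l(1) by (intro scalar_prod_minus_distrib) auto
  ultimately show ?thesis
    using l(3) by simp
qed

text \<open>On an equality row both sides agree, whatever the sign of \<open>l\<close>; on an
  inequality row a nonnegative multiplier preserves the inequality. Summing over the rows gives the
  bound.\<close>

lemma lp_weak_duality:
  assumes A: "A\<^sub>E \<in> carrier_mat m\<^sub>E n" "A\<^sub>I \<in> carrier_mat m\<^sub>I n"
    and b: "b\<^sub>E \<in> carrier_vec m\<^sub>E" "b\<^sub>I \<in> carrier_vec m\<^sub>I"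
    and mult: "lp_multiplier A\<^sub>E b\<^sub>E A\<^sub>I b\<^sub>I c x l"
    and feas: "lp_feasible n A\<^sub>E b\<^sub>E A\<^sub>I b\<^sub>I y"
  shows "l \<bullet> (b\<^sub>E @\<^sub>v b\<^sub>I) \<le> c \<bullet> y"
proof -
  let ?A = "A\<^sub>E @\<^sub>r A\<^sub>I" and ?b = "b\<^sub>E @\<^sub>v b\<^sub>I"
  have cA: "?A \<in> carrier_mat (m\<^sub>E + m\<^sub>I) n" and cb: "?b \<in> carrier_vec (m\<^sub>E + m\<^sub>I)"
    using A b by auto
  have l: "l \<in> carrier_vec (m\<^sub>E + m\<^sub>I)" "?A\<^sup>T *\<^sub>v l = c" "\<forall>i\<in>{m\<^sub>E..<m\<^sub>E + m\<^sub>I}. l $ i \<ge> 0"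
    using mult unfolding lp_multiplier_iff[OF A] by auto
  have y: "y \<in> carrier_vec n" "\<forall>i<m\<^sub>E. (?A *\<^sub>v y) $ i = ?b $ i"
    "\<forall>i\<in>{m\<^sub>E..<m\<^sub>E + m\<^sub>I}. (?A *\<^sub>v y) $ i \<ge> ?b $ i"
    using feas unfolding lp_feasible_iff[OF A b] by auto
  have "l $ i * ?b $ i \<le> l $ i * (?A *\<^sub>v y) $ i" if "i < m\<^sub>E + m\<^sub>I" for i
    using that l(3) y(2,3) by (cases "i < m\<^sub>E") (simp_all add: mult_left_mono del: index_mult_mat_vec)
  then have "(\<Sum>i\<in>{0..<m\<^sub>E + m\<^sub>I}. l $ i * ?b $ i) \<le> (\<Sum>i\<in>{0..<m\<^sub>E + m\<^sub>I}. l $ i * (?A *\<^sub>v y) $ i)"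
    by (intro sum_mono) auto
  then have "l \<bullet> ?b \<le> l \<bullet> (?A *\<^sub>v y)"
    using carrier_vecD[OF cb] carrier_matD(1)[OF cA] by (simp add: scalar_prod_def del: index_mult_mat_vec)
  also have "\<dots> = c \<bullet> y"
    using transpose_vec_mult_scalar[OF cA y(1) l(1)] l(2) by simp
  finally show ?thesis .
qed

section \<open>Necessity: multipliers at an optimal point\<close>

text \<open>Only the constraints active at \<open>x\<close> restrict the direction \<open>d\<close>: the inactive ones survive
  a sufficiently small step.\<close>

lemma lp_optimal_feasible_direction:
  assumes A: "A\<^sub>E \<in> carrier_mat m\<^sub>E n" "A\<^sub>I \<in> carrier_mat m\<^sub>I n"
    and b: "b\<^sub>E \<in> carrier_vec m\<^sub>E" "b\<^sub>I \<in> carrier_vec m\<^sub>I" and c: "c \<in> carrier_vec n"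
    and opt: "lp_optimal n A\<^sub>E b\<^sub>E A\<^sub>I b\<^sub>I c x" and d: "d \<in> carrier_vec n"
    and dE: "\<And>i. i < m\<^sub>E \<Longrightarrow> ((A\<^sub>E @\<^sub>r A\<^sub>I) *\<^sub>v d) $ i = 0"
    and dI: "\<And>i. i \<in> {m\<^sub>E..<m\<^sub>E + m\<^sub>I} \<Longrightarrow>
      ((A\<^sub>E @\<^sub>r A\<^sub>I) *\<^sub>v x) $ i = (b\<^sub>E @\<^sub>v b\<^sub>I) $ i \<Longrightarrow> ((A\<^sub>E @\<^sub>r A\<^sub>I) *\<^sub>v d) $ i \<ge> 0"
  shows "c \<bullet> d \<ge> 0"
proof -
  let ?A = "A\<^sub>E @\<^sub>r A\<^sub>I" and ?b = "b\<^sub>E @\<^sub>v b\<^sub>I"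
  have cA: "?A \<in> carrier_mat (m\<^sub>E + m\<^sub>I) n"
    using A by auto
  have x: "x \<in> carrier_vec n" "\<forall>i<m\<^sub>E. (?A *\<^sub>v x) $ i = ?b $ i"
    "\<forall>i\<in>{m\<^sub>E..<m\<^sub>E + m\<^sub>I}. (?A *\<^sub>v x) $ i \<ge> ?b $ i"
    using opt unfolding lp_optimal_def lp_feasible_iff[OF A b] by auto
  have "\<forall>\<^sub>F t in at_right 0. (?A *\<^sub>v x) $ i + t * (?A *\<^sub>v d) $ i \<ge> ?b $ i"
    if i: "i \<in> {m\<^sub>E..<m\<^sub>E + m\<^sub>I}" for i
  proof (cases "(?A *\<^sub>v x) $ i = ?b $ i")
    case True
    then show ?thesis
      using dI[OF i True] by (auto intro!: eventually_at_rightI[of 0 1])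
  next
    case False
    \<comment> \<open>The strict inequality at \<open>t = 0\<close> persists for small
      \<open>t\<close> by continuity.\<close>
    have "((\<lambda>t. (?A *\<^sub>v x) $ i + t * (?A *\<^sub>v d) $ i) \<longlongrightarrow> (?A *\<^sub>v x) $ i + 0 * (?A *\<^sub>v d) $ i) (at_right 0)"
      by (intro tendsto_intros)
    moreover have "?b $ i < (?A *\<^sub>v x) $ i + 0 * (?A *\<^sub>v d) $ i"
      using x(3) i False by (simp add: less_le del: index_mult_mat_vec)
    ultimately have "\<forall>\<^sub>F t in at_right 0. ?b $ i < (?A *\<^sub>v x) $ i + t * (?A *\<^sub>v d) $ i"
      by (rule order_tendstoD(1))
    then show ?thesis
      by (rule eventually_mono) simp
  qed
  \<comment> \<open>There are finitely many rows, so one step length serves all of them.\<close>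
  then have "\<forall>\<^sub>F t in at_right 0. \<forall>i\<in>{m\<^sub>E..<m\<^sub>E + m\<^sub>I}. (?A *\<^sub>v x) $ i + t * (?A *\<^sub>v d) $ i \<ge> ?b $ i"
    by (simp add: eventually_ball_finite del: index_mult_mat_vec)
  moreover have "\<forall>\<^sub>F t in at_right (0::real). t > 0"
    by (rule eventually_at_right_less)
  ultimately have "\<forall>\<^sub>F t in at_right 0. t > 0 \<and>
      (\<forall>i\<in>{m\<^sub>E..<m\<^sub>E + m\<^sub>I}. (?A *\<^sub>v x) $ i + t * (?A *\<^sub>v d) $ i \<ge> ?b $ i)"
    by (simp add: eventually_conj_iff)
  then obtain t :: real where t: "t > 0"
    "\<forall>i\<in>{m\<^sub>E..<m\<^sub>E + m\<^sub>I}. (?A *\<^sub>v x) $ i + t * (?A *\<^sub>v d) $ i \<ge> ?b $ i"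
    using eventually_happens'[OF trivial_limit_at_right_real] by blast
  have td: "t \<cdot>\<^sub>v d \<in> carrier_vec n"
    using d by simp
  have "(?A *\<^sub>v (x + t \<cdot>\<^sub>v d)) $ i = (?A *\<^sub>v x) $ i + t * (?A *\<^sub>v d) $ i" if "i < m\<^sub>E + m\<^sub>I" for i
    using that cA x(1) d td
    by (simp add: mult_add_distrib_mat_vec[OF cA] mult_mat_vec[OF cA] del: index_mult_mat_vec)
  then have "lp_feasible n A\<^sub>E b\<^sub>E A\<^sub>I b\<^sub>I (x + t \<cdot>\<^sub>v d)"
    unfolding lp_feasible_iff[OF A b] using x td t(2) dE by (simp del: index_mult_mat_vec)
  \<comment> \<open>The objective is linear along \<open>d\<close>, so optimality against this
    feasible point bounds \<open>t * (c \<bullet> d)\<close> from below by 0.\<close>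
  then have "c \<bullet> x \<le> c \<bullet> (x + t \<cdot>\<^sub>v d)"
    using opt by (simp add: lp_optimal_def)
  also have "\<dots> = c \<bullet> x + t * (c \<bullet> d)"
    using c x(1) d td by (simp add: scalar_prod_add_distrib[of _ n])
  finally show ?thesis
    using \<open>t > 0\<close> by (simp add: zero_le_mult_iff)
qed

text \<open>The feasible-direction lemma is exactly the hypothesis of Farkas' lemma for the equality
  rows and the active inequality rows. Giving the inactive rows multiplier 0 makes complementarity
  automatic.\<close>

lemma lp_optimal_multiplier_exists:
  assumes A: "A\<^sub>E \<in> carrier_mat m\<^sub>E n" "A\<^sub>I \<in> carrier_mat m\<^sub>I n"
    and b: "b\<^sub>E \<in> carrier_vec m\<^sub>E" "b\<^sub>I \<in> carrier_vec m\<^sub>I" and c: "c \<in> carrier_vec n"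
    and opt: "lp_optimal n A\<^sub>E b\<^sub>E A\<^sub>I b\<^sub>I c x"
  shows "\<exists>l. lp_multiplier A\<^sub>E b\<^sub>E A\<^sub>I b\<^sub>I c x l"
proof -
  let ?A = "A\<^sub>E @\<^sub>r A\<^sub>I" and ?b = "b\<^sub>E @\<^sub>v b\<^sub>I"
  have cA: "?A \<in> carrier_mat (m\<^sub>E + m\<^sub>I) n" and cb: "?b \<in> carrier_vec (m\<^sub>E + m\<^sub>I)"
    using A b by auto
  have x: "x \<in> carrier_vec n" "\<forall>i<m\<^sub>E. (?A *\<^sub>v x) $ i = ?b $ i"
    using opt unfolding lp_optimal_def lp_feasible_iff[OF A b] by auto
  \<comment> \<open>Only inequality rows are collected: the equality rows enter separately, to leave
    their multipliers free in sign.\<close>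
  define act where "act = {i \<in> {m\<^sub>E..<m\<^sub>E + m\<^sub>I}. (?A *\<^sub>v x) $ i = ?b $ i}"
  \<comment> \<open>Farkas' lemma speaks of coordinate functions; this translates them into
    vectors.\<close>
  have ip: "(\<Sum>j\<in>{0..<n}. ?A $$ (i, j) * u j) = (?A *\<^sub>v vec n u) $ i" if "i < m\<^sub>E + m\<^sub>I" for i u
    using that cA by (simp add: scalar_prod_def)
  have dir: "(\<Sum>j\<in>{0..<n}. c $ j * u j) \<ge> 0"
    if uE: "\<And>i. i \<in> {0..<m\<^sub>E} \<Longrightarrow> (\<Sum>j\<in>{0..<n}. ?A $$ (i, j) * u j) = 0"
      and uI: "\<And>i. i \<in> act \<Longrightarrow> (\<Sum>j\<in>{0..<n}. ?A $$ (i, j) * u j) \<ge> 0" for u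
  proof -
    have "c \<bullet> vec n u \<ge> 0"
    proof (rule lp_optimal_feasible_direction[OF A b c opt])
      show "(?A *\<^sub>v vec n u) $ i = 0" if "i < m\<^sub>E" for i
        using uE[of i] ip[of i u] that by (simp del: index_mult_mat_vec)
      show "(?A *\<^sub>v vec n u) $ i \<ge> 0"
        if "i \<in> {m\<^sub>E..<m\<^sub>E + m\<^sub>I}" "(?A *\<^sub>v x) $ i = ?b $ i" for i
        using uI[of i] ip[of i u] that by (simp add: act_def del: index_mult_mat_vec)
    qed simp
    then show ?thesis
      by (simp add: scalar_prod_def)
  qed
  obtain f where f: "\<And>i. i \<in> act \<Longrightarrow> f i \<ge> 0"
    "\<And>j. j \<in> {0..<n} \<Longrightarrow> c $ j = (\<Sum>i\<in>{0..<m\<^sub>E} \<union> act. f i * ?A $$ (i, j))"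
  proof (rule farkas_equalities[of "{0..<m\<^sub>E}" act "{0..<n}" "\<lambda>i j. ?A $$ (i, j)" "\<lambda>j. c $ j"])
    show "{0..<m\<^sub>E} \<inter> act = {}" "finite act"
      by (auto simp: act_def)
  qed (use dir in auto)
  let ?S = "{0..<m\<^sub>E} \<union> act"
  define l where "l = vec (m\<^sub>E + m\<^sub>I) (\<lambda>i. if i \<in> ?S then f i else 0)"
  have "(?A\<^sup>T *\<^sub>v l) $ j = c $ j" if "j < n" for j
  proof -
    have "(?A\<^sup>T *\<^sub>v l) $ j = (\<Sum>i\<in>{0..<m\<^sub>E + m\<^sub>I}. ?A $$ (i, j) * (if i \<in> ?S then f i else 0))"
      using cA that by (simp add: scalar_prod_def l_def)
    also have "\<dots> = (\<Sum>i\<in>?S. f i * ?A $$ (i, j))"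
      by (rule sum.mono_neutral_cong_right) (auto simp: act_def)
    finally show ?thesis
      using f(2) that by simp
  qed
  then have "?A\<^sup>T *\<^sub>v l = c"
    using cA c by (intro eq_vecI) auto
  moreover have "l \<bullet> (?A *\<^sub>v x - ?b) = 0"
    unfolding scalar_prod_def
  \<comment> \<open>Each product vanishes by itself: the slack is 0 on rows in \<open>?S\<close>,
    the multiplier elsewhere.\<close>
  proof (rule sum.neutral, rule ballI)
    fix i assume "i \<in> {0..<dim_vec (?A *\<^sub>v x - ?b)}"
    then have "i < m\<^sub>E + m\<^sub>I"
      using carrier_vecD[OF cb] by simp
    then show "l $ i * (?A *\<^sub>v x - ?b) $ i = 0"
      using x(2) carrier_vecD[OF cb] by (auto simp: l_def act_def simp del: index_mult_mat_vec)
  qed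
  moreover have "\<forall>i\<in>{m\<^sub>E..<m\<^sub>E + m\<^sub>I}. l $ i \<ge> 0" "l \<in> carrier_vec (m\<^sub>E + m\<^sub>I)"
    using f(1) by (auto simp: l_def)
  ultimately show ?thesis
    unfolding lp_multiplier_iff[OF A] by blast
qed

theorem proposition7p1:
  fixes n m\<^sub>E m\<^sub>I :: nat
    and A\<^sub>E A\<^sub>I :: "real mat"
    and b\<^sub>E b\<^sub>I c x :: "real vec"
  assumes "A\<^sub>E \<in> carrier_mat m\<^sub>E n" and "A\<^sub>I \<in> carrier_mat m\<^sub>I n"
    and "b\<^sub>E \<in> carrier_vec m\<^sub>E" and "b\<^sub>I \<in> carrier_vec m\<^sub>I"
    and "c \<in> carrier_vec n"
    and "vec_space.rank m\<^sub>E A\<^sub>E = m\<^sub>E"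
    and "c \<noteq> 0\<^sub>v n"
    and "A\<^sub>E @\<^sub>r A\<^sub>I \<noteq> 0\<^sub>m (m\<^sub>E + m\<^sub>I) n"
    and "\<exists>y. lp_feasible n A\<^sub>E b\<^sub>E A\<^sub>I b\<^sub>I y"
    and "bdd_below ((\<lambda>y. c \<bullet> y) ` {y. lp_feasible n A\<^sub>E b\<^sub>E A\<^sub>I b\<^sub>I y})"
    and "vec_space.rank (m\<^sub>E + m\<^sub>I) (A\<^sub>E @\<^sub>r A\<^sub>I) = n"
    and "x \<in> carrier_vec n"
  shows "(lp_optimal n A\<^sub>E b\<^sub>E A\<^sub>I b\<^sub>I c x \<longleftrightarrow>
            lp_feasible n A\<^sub>E b\<^sub>E A\<^sub>I b\<^sub>I x \<and> (\<exists>l. lp_multiplier A\<^sub>E b\<^sub>E A\<^sub>I b\<^sub>I c x l)) \<and>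
         (\<forall>l. lp_feasible n A\<^sub>E b\<^sub>E A\<^sub>I b\<^sub>I x \<and> lp_multiplier A\<^sub>E b\<^sub>E A\<^sub>I b\<^sub>I c x l \<longrightarrow>
            lp_optimal_value n A\<^sub>E b\<^sub>E A\<^sub>I b\<^sub>I c = l \<bullet> (b\<^sub>E @\<^sub>v b\<^sub>I))"
proof -
  have objective: "c \<bullet> x = l \<bullet> (b\<^sub>E @\<^sub>v b\<^sub>I)" if "lp_multiplier A\<^sub>E b\<^sub>E A\<^sub>I b\<^sub>I c x l" for l
    using lp_multiplier_objective assms(1-4,12) that by blast
  have optimal: "lp_optimal n A\<^sub>E b\<^sub>E A\<^sub>I b\<^sub>I c x"
    if "lp_feasible n A\<^sub>E b\<^sub>E A\<^sub>I b\<^sub>I x" "lp_multiplier A\<^sub>E b\<^sub>E A\<^sub>I b\<^sub>I c x l" for l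
    unfolding lp_optimal_def using that lp_weak_duality[OF assms(1-4)] objective by metis
  \<comment> \<open>The infimum is attained at an optimal point, hence is a minimum.\<close>
  have "lp_optimal_value n A\<^sub>E b\<^sub>E A\<^sub>I b\<^sub>I c = c \<bullet> x" if "lp_optimal n A\<^sub>E b\<^sub>E A\<^sub>I b\<^sub>I c x"
    unfolding lp_optimal_value_def
    by (rule cInf_eq_minimum) (use that in \<open>auto simp: lp_optimal_def\<close>)
  then show ?thesis
    using optimal objective lp_optimal_multiplier_exists[OF assms(1-5)]
    by (metis lp_optimal_def)
qed

end
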